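(* Let $n\ge 1$ and let $p = m/n$ for some $m \in \{0,1,\ldots,n\}$. Then the parity function on $n-m$ variables, $$f:\{-1,1\}^n\to\{-1,1\},\qquad f(x_1,\ldots, x_n) = x_{m+1} x_{m+2}\cdots x_n$$ (the constant function $1$ if $m=n$), is locally $p$-stable.
   Context: The hypercube $\{-1,1\}^n$ is regarded as a graph in which two vertices are adjacent iff they differ in exactly one coordinate. A function $f:\{-1,1\}^n\to\{-1,1\}$ is called locally $p$-stable if for every vertex $x$, $|\{y\sim x : f(y)=f(x)\}|/n = p$. *)

theory Defs
  imports Complex_Main "HOL-Library.FuncSet"
begin

text \<open>Coordinates are indexed by \<open>1, \<dots>, n\<close>. The extensional function space makes every vertex
  be represented by exactly one function, so that counting neighbours is meaningful.\<close>

definition hypercube :: "nat \<Rightarrow> (nat \<Rightarrow> int) set" where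
  "hypercube n = ({1..n} \<rightarrow>\<^sub>E {-1, 1})"

definition hypercube_adj :: "nat \<Rightarrow> (nat \<Rightarrow> int) \<Rightarrow> (nat \<Rightarrow> int) \<Rightarrow> bool" where
  "hypercube_adj n x y \<longleftrightarrow>
     x \<in> hypercube n \<and> y \<in> hypercube n \<and> card {i \<in> {1..n}. x i \<noteq> y i} = 1"

definition locally_stable :: "nat \<Rightarrow> real \<Rightarrow> ((nat \<Rightarrow> int) \<Rightarrow> int) \<Rightarrow> bool" where
  "locally_stable n p f \<longleftrightarrow>
     f \<in> hypercube n \<rightarrow> {-1, 1} \<and>
     (\<forall>x \<in> hypercube n. real (card {y. hypercube_adj n x y \<and> f y = f x}) / real n = p)"

end

theory Submission
  imports Defs
begin

text \<open>
  The neighbours of a vertex are obtained by negating one coordinate, and distinct coordinates give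
  distinct neighbours. Negating a coordinate that occurs in a monomial \<open>\<Prod>i\<in>A. x i\<close> reverses the
  sign of that monomial, whose value is never zero, and negating any other coordinate leaves it
  unchanged. So the neighbours on which the monomial keeps its value correspond to the coordinates
  outside \<open>A\<close>; for \<open>A = {m + 1..n}\<close> these are the \<open>m\<close> coordinates in \<open>{1..m}\<close>, at every vertex.
\<close>

definition flip :: "(nat \<Rightarrow> int) \<Rightarrow> nat \<Rightarrow> nat \<Rightarrow> int" where
  "flip x i = x(i := - x i)"

lemma hypercube_coord:
  assumes "x \<in> hypercube n" and "i \<in> {1..n}"
  shows "x i = 1 \<or> x i = -1"
  using PiE_mem[OF assms[unfolded hypercube_def]] by auto

lemma flip_in_hypercube:
  assumes "x \<in> hypercube n" and "i \<in> {1..n}"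
  shows "flip x i \<in> hypercube n"
  using assms hypercube_coord[OF assms]
  by (auto simp: hypercube_def flip_def PiE_iff extensional_def)

text \<open>Two distinct values in \<open>{-1, 1}\<close> are negatives of each other, so a vertex that differs from
  \<open>x\<close> only at \<open>i\<close> can only be \<open>flip x i\<close>; outside \<open>{1..n}\<close> both vertices take the
  same default value.\<close>

lemma hypercube_adj_iff_flip:
  assumes x: "x \<in> hypercube n"
  shows "hypercube_adj n x y \<longleftrightarrow> (\<exists>i\<in>{1..n}. y = flip x i)"
proof
  assume adj: "hypercube_adj n x y"
  then have y: "y \<in> hypercube n"
    by (simp add: hypercube_adj_def)
  from adj obtain i where i: "{j \<in> {1..n}. x j \<noteq> y j} = {i}"
    by (auto simp: hypercube_adj_def card_1_singleton_iff)
  have "i \<in> {j \<in> {1..n}. x j \<noteq> y j}"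
    unfolding i by simp
  then have i_mem: "i \<in> {1..n}" and diff: "x i \<noteq> y i"
    by blast+
  have "y j = flip x i j" for j
  proof (cases "j \<in> {1..n}")
    case True
    have "j = i" if "x j \<noteq> y j"
      using i True that by blast
    then show ?thesis
      using diff hypercube_coord[OF x True] hypercube_coord[OF y True]
      by (cases "j = i") (auto simp: flip_def)
  next
    case False
    then show ?thesis
      using x y i_mem by (auto simp: hypercube_def flip_def PiE_iff extensional_def)
  qed
  then show "\<exists>i\<in>{1..n}. y = flip x i"
    using i_mem by blast
next
  assume "\<exists>i\<in>{1..n}. y = flip x i"
  then obtain i where i: "i \<in> {1..n}" and y: "y = flip x i"
    by blast
  have "{j \<in> {1..n}. x j \<noteq> y j} = {i}"
    using i hypercube_coord[OF x i] by (auto simp: y flip_def)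
  then show "hypercube_adj n x y"
    using x i flip_in_hypercube[OF x i] by (simp add: hypercube_adj_def y)
qed

lemma inj_on_flip:
  assumes x: "x \<in> hypercube n"
  shows "inj_on (flip x) {1..n}"
proof (rule inj_onI)
  fix i j
  assume i: "i \<in> {1..n}" and "flip x i = flip x j"
  then have "flip x i i = flip x j i"
    by simp
  then show "i = j"
    using hypercube_coord[OF x i] by (auto simp: flip_def split: if_splits)
qed

lemma prod_flip:
  assumes "finite A"
  shows "(\<Prod>j\<in>A. flip x i j) = (if i \<in> A then - (\<Prod>j\<in>A. x j) else (\<Prod>j\<in>A. x j))"
proof (cases "i \<in> A")
  case True
  have "(\<Prod>j\<in>A - {i}. flip x i j) = (\<Prod>j\<in>A - {i}. x j)"
    by (rule prod.cong) (auto simp: flip_def)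
  then show ?thesis
    using True by (simp add: prod.remove[OF assms True] flip_def)
next
  case False
  have "(\<Prod>j\<in>A. flip x i j) = (\<Prod>j\<in>A. x j)"
    using False by (intro prod.cong) (auto simp: flip_def)
  then show ?thesis
    using False by simp
qed

lemma monomial_values:
  assumes "x \<in> hypercube n" and "A \<subseteq> {1..n}"
  shows "(\<Prod>i\<in>A. x i) \<in> {-1, 1}"
proof -
  have "\<forall>i\<in>A. x i \<in> {-1, 1}"
    using hypercube_coord[OF assms(1)] assms(2) by blast
  then show ?thesis
    by (induction A rule: infinite_finite_induct) auto
qed

lemma card_neighbours_same_monomial:
  assumes x: "x \<in> hypercube n" and A: "A \<subseteq> {1..n}"
  shows "card {y. hypercube_adj n x y \<and> (\<Prod>i\<in>A. y i) = (\<Prod>i\<in>A. x i)} = n - card A"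
proof -
  have fin: "finite A"
    using A finite_subset by blast
  have "(\<Prod>j\<in>A. flip x i j) = (\<Prod>j\<in>A. x j) \<longleftrightarrow> i \<notin> A" for i
    using monomial_values[OF x A] by (auto simp: prod_flip[OF fin])
  then have "{y. hypercube_adj n x y \<and> (\<Prod>i\<in>A. y i) = (\<Prod>i\<in>A. x i)} = flip x ` ({1..n} - A)"
    by (auto simp: hypercube_adj_iff_flip[OF x])
  moreover have "inj_on (flip x) ({1..n} - A)"
    using inj_on_flip[OF x] by (rule inj_on_subset) blast
  ultimately show ?thesis
    using A fin by (simp add: card_image card_Diff_subset)
qed

theorem mainTheorem13:
  fixes n m :: nat and p :: real
  assumes "n \<ge> 1"
    and "m \<in> {0..n}"
    and "p = real m / real n"
  shows "locally_stable n p (\<lambda>x. \<Prod>i = m + 1..n. x i)"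
proof -
  have A: "{m + 1..n} \<subseteq> {1..n}"
    by auto
  have m: "n - card {m + 1..n} = m"
    using assms(2) by simp
  show ?thesis
    unfolding locally_stable_def
  proof (intro conjI ballI Pi_I)
    fix x
    assume x: "x \<in> hypercube n"
    show "(\<Prod>i = m + 1..n. x i) \<in> {-1, 1}"
      by (rule monomial_values[OF x A])
    show "real (card {y. hypercube_adj n x y \<and> (\<Prod>i = m + 1..n. y i) = (\<Prod>i = m + 1..n. x i)})
        / real n = p"
      unfolding card_neighbours_same_monomial[OF x A] m assms(3) ..
  qed
qed

end
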